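(* Let $G$ be a graph and let $H$ be a connected graph on $k>1$ vertices. Then $\lambda(G,H)\le \lambda(G,K_2)$.
   Context: All graphs are finite and simple. For a graph $G$, $d_v$ denotes the degree of $v$, $u\sim v$ means adjacency, and $\mathrm{vol}(G)=\sum_v d_v$. For a metric space $(X,d)$ and $f:V(G)\to X$ set $R_f(G,X)=\frac{\mathrm{vol}(G)\sum_{u\sim v} d(f(u),f(v))^2}{\sum_{u,v} d(f(u),f(v))^2 d_u d_v}$, where the numerator sum is over edges of $G$ and the denominator sum over unordered pairs of vertices; $\lambda(G,X)=\inf_f R_f(G,X)$ over all $f$ with nonzero denominator. A connected graph $H$ is regarded as the metric space $(V(H),d_H)$ with shortest-path distance, and $\lambda(G,H)=\lambda(G,(V(H),d_H))$. $K_2$ is the graph consisting of a single edge. *)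

theory Defs
  imports "HOL-Analysis.Analysis" "Graph_Theory.Graph_Theory"
begin

text \<open>
  A finite simple graph is a \<open>pair_graph\<close>: a finite, loop-free symmetric digraph whose arcs are
  pairs, so that each undirected edge is present as two opposite arcs.  The sums below range over
  undirected edges and unordered pairs, i.e. over two-element sets \<open>{u, v}\<close>.
\<close>

definition edges :: "'a pair_pre_digraph \<Rightarrow> 'a set set" where
  "edges G = {{u, v} | u v. (u, v) \<in> parcs G}"

text \<open>Pairs with \<open>u = v\<close> are left out; they would contribute \<open>0\<close> to the sum in question.\<close>

definition vertex_pairs :: "'a pair_pre_digraph \<Rightarrow> 'a set set" where
  "vertex_pairs G = {{u, v} | u v. u \<in> pverts G \<and> v \<in> pverts G \<and> u \<noteq> v}"

text \<open>The value \<open>g u v\<close> of a symmetric function as a function of the unordered pair \<open>{u, v}\<close>.\<close>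

definition on_pair :: "('a \<Rightarrow> 'a \<Rightarrow> real) \<Rightarrow> 'a set \<Rightarrow> real" where
  "on_pair g e = (THE r. \<exists>u v. e = {u, v} \<and> r = g u v)"

lemma on_pair_eq: "g u v = g v u \<Longrightarrow> on_pair g {u, v} = g u v"
  unfolding on_pair_def by (rule the_equality) (auto simp: doubleton_eq_iff)

text \<open>Every edge at \<open>v\<close> gives exactly one arc leaving \<open>v\<close>.\<close>

definition degree :: "'a pair_pre_digraph \<Rightarrow> 'a \<Rightarrow> nat" where
  "degree G v = out_degree (with_proj G) v"

definition vol :: "'a pair_pre_digraph \<Rightarrow> real" where
  "vol G = (\<Sum>v\<in>pverts G. real (degree G v))"

definition energy :: "'a pair_pre_digraph \<Rightarrow> 'x metric \<Rightarrow> ('a \<Rightarrow> 'x) \<Rightarrow> real" where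
  "energy G X f = (\<Sum>e\<in>edges G. on_pair (\<lambda>u v. (mdist X (f u) (f v))\<^sup>2) e)"

definition dispersion :: "'a pair_pre_digraph \<Rightarrow> 'x metric \<Rightarrow> ('a \<Rightarrow> 'x) \<Rightarrow> real" where
  "dispersion G X f = (\<Sum>e\<in>vertex_pairs G.
     on_pair (\<lambda>u v. (mdist X (f u) (f v))\<^sup>2 * real (degree G u) * real (degree G v)) e)"

definition rayleigh :: "'a pair_pre_digraph \<Rightarrow> 'x metric \<Rightarrow> ('a \<Rightarrow> 'x) \<Rightarrow> real" where
  "rayleigh G X f = vol G * energy G X f / dispersion G X f"

text \<open>Extended-real infimum: it is \<open>\<infinity>\<close> if no \<open>f\<close> has nonzero denominator (e.g. \<open>G\<close> edgeless).\<close>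

definition lambda_metric :: "'a pair_pre_digraph \<Rightarrow> 'x metric \<Rightarrow> ereal" where
  "lambda_metric G X =
     (INF f\<in>{f \<in> pverts G \<rightarrow> mspace X. dispersion G X f \<noteq> 0}. ereal (rayleigh G X f))"

definition graph_dist :: "'a pair_pre_digraph \<Rightarrow> 'a \<Rightarrow> 'a \<Rightarrow> real" where
  "graph_dist H u v = real_of_ereal (wf_digraph.\<mu> (with_proj H) (\<lambda>_. 1) u v)"

text \<open>Meaningful for connected \<open>H\<close>, by \<open>Metric_space_graph_dist\<close> below.\<close>

definition graph_metric :: "'a pair_pre_digraph \<Rightarrow> 'a metric" where
  "graph_metric H = metric (pverts H, graph_dist H)"

definition lambda_graph :: "'a pair_pre_digraph \<Rightarrow> 'b pair_pre_digraph \<Rightarrow> ereal" where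
  "lambda_graph G H = lambda_metric G (graph_metric H)"

definition K2 :: "nat pair_pre_digraph" where
  "K2 = \<lparr>pverts = {0, 1}, parcs = {(0, 1), (1, 0)}\<rparr>"

lemma complete_digraph_K2: "complete_digraph 2 (with_proj K2)"
  unfolding complete_digraph_pair_def by (auto simp: K2_def)

lemma pair_graph_K2: "pair_graph K2"
  using complete_digraph_K2 by (rule pair_graphI_complete)

lemma graph_dist_walk:
  assumes "pair_graph H" "Digraph_Component.connected (with_proj H)"
    and "u \<in> pverts H" "v \<in> pverts H"
  obtains p where "pre_digraph.awalk (with_proj H) u p v" "graph_dist H u v = real (length p)"
proof -
  interpret pair_graph H by fact
  have cost: "awalk_cost (\<lambda>_. 1) p = real (length p)" for p
    by (induction p) auto
  have "strongly_connected (with_proj H)"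
    using assms(2) by (rule symmetric_connected_imp_strongly_connected[OF pair_sym_arcs])
  then have "u \<rightarrow>\<^sup>*\<^bsub>with_proj H\<^esub> v"
    using assms(3,4) by (auto simp: strongly_connected_def)
  moreover have "\<not> (\<exists>w c. awalk w c w \<and> w \<in> set (awalk_verts u p) \<and> awalk_cost (\<lambda>_. 1) c < 0)" for p
    by (auto simp: cost)
  ultimately obtain p where "apath u p v" "\<mu> (\<lambda>_. 1) u v = awalk_cost (\<lambda>_. 1) p"
    using no_neg_cyc_reach_imp_path[of u v "\<lambda>_. 1"] by auto
  then show thesis
    using that[of p] by (auto simp: graph_dist_def cost apath_def)
qed

lemma graph_dist_le:
  assumes "pair_graph H" "pre_digraph.awalk (with_proj H) u p v"
  shows "graph_dist H u v \<le> real (length p)"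
proof -
  interpret pair_graph H by fact
  have cost: "awalk_cost (\<lambda>_. 1) p = real (length p)" for p
    by (induction p) auto
  have "\<mu> (\<lambda>_. 1) u v \<le> ereal (real (length p))"
    using min_cost_le_walk_cost[OF assms(2), of "\<lambda>_. 1"] by (simp add: cost)
  moreover have "0 \<le> \<mu> (\<lambda>_. 1) u v"
    unfolding \<mu>_def by (rule INF_greatest) (simp add: cost)
  ultimately show ?thesis
    unfolding graph_dist_def by (cases "\<mu> (\<lambda>_. 1) u v") auto
qed

lemma awalk_reverse:
  assumes "pair_graph H" "pre_digraph.awalk (with_proj H) u p v"
  shows "\<exists>q. pre_digraph.awalk (with_proj H) v q u \<and> length q = length p"
proof -
  interpret pair_graph H by fact
  show ?thesis
    using assms(2)
  proof (induction p arbitrary: u)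
    case Nil
    then show ?case by (auto simp: awalk_Nil_iff)
  next
    case (Cons e p)
    then have e: "e \<in> parcs H" "fst e = u" "awalk (snd e) p v"
      by (auto simp: awalk_Cons_iff)
    then obtain q where q: "awalk v q (snd e)" "length q = length p"
      using Cons.IH by blast
    have "(snd e, u) \<in> parcs H"
      using e pair_sym_arcs by (cases e) (auto simp: symmetric_def dest: symD)
    then have "awalk (snd e) [(snd e, u)] u"
      by (auto simp: awalk_Cons_iff awalk_Nil_iff intro: in_arcsD2)
    with q have "awalk v (q @ [(snd e, u)]) u"
      by (auto intro: awalk_appendI)
    then show ?case
      using q(2) by (intro exI[of _ "q @ [(snd e, u)]"]) simp
  qed
qed

lemma Metric_space_graph_dist:
  assumes "pair_graph H" "Digraph_Component.connected (with_proj H)"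
  shows "Metric_space (pverts H) (graph_dist H)"
proof -
  interpret pair_graph H by fact
  have nonneg: "0 \<le> graph_dist H u v" for u v
  proof -
    have cost: "awalk_cost (\<lambda>_. 1) p = real (length p)" for p
      by (induction p) auto
    have "0 \<le> \<mu> (\<lambda>_. 1) u v"
      unfolding \<mu>_def by (rule INF_greatest) (simp add: cost)
    then show ?thesis
      by (simp add: graph_dist_def real_of_ereal_pos)
  qed
  have outside: "graph_dist H u v = 0" if "u \<notin> pverts H \<or> v \<notin> pverts H" for u v
  proof -
    have "{p. awalk u p v} = {}"
      using that by (auto dest: awalk_hd_in_verts awalk_last_in_verts)
    then show ?thesis
      by (simp add: graph_dist_def \<mu>_def top_ereal_def)
  qed
  have le: "graph_dist H u v \<le> graph_dist H v u" for u v
  proof (cases "u \<in> pverts H \<and> v \<in> pverts H")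
    case True
    then obtain p where "awalk v p u" "graph_dist H v u = real (length p)"
      using graph_dist_walk[OF assms] by metis
    then show ?thesis
      using awalk_reverse[OF assms(1)] graph_dist_le[OF assms(1)] by metis
  next
    case False
    then show ?thesis using outside[of u v] nonneg by simp
  qed
  show ?thesis
  proof
    show "0 \<le> graph_dist H u v" for u v by (rule nonneg)
    show "graph_dist H u v = graph_dist H v u" for u v
      by (rule antisym) (rule le)+
    show "graph_dist H u v = 0 \<longleftrightarrow> u = v" if uv: "u \<in> pverts H" "v \<in> pverts H" for u v
    proof
      assume "graph_dist H u v = 0"
      moreover obtain p where "awalk u p v" "graph_dist H u v = real (length p)"
        by (rule graph_dist_walk[OF assms uv])
      ultimately show "u = v" by (auto simp: awalk_Nil_iff)
    next
      assume "u = v"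
      then have "awalk u [] v" using uv by (simp add: awalk_Nil_iff)
      then show "graph_dist H u v = 0"
        using graph_dist_le[OF assms(1), of u "[]" v] nonneg[of u v] by simp
    qed
    show "graph_dist H u w \<le> graph_dist H u v + graph_dist H v w"
      if uvw: "u \<in> pverts H" "v \<in> pverts H" "w \<in> pverts H" for u v w
    proof -
      obtain p where p: "awalk u p v" "graph_dist H u v = real (length p)"
        using graph_dist_walk[OF assms] uvw by metis
      obtain q where q: "awalk v q w" "graph_dist H v w = real (length q)"
        using graph_dist_walk[OF assms] uvw by metis
      have "awalk u (p @ q) w" using p q by (auto intro: awalk_appendI)
      from graph_dist_le[OF assms(1) this] show ?thesis using p q by simp
    qed
  qed
qed

lemma mspace_graph_metric:
  assumes "pair_graph H" "Digraph_Component.connected (with_proj H)"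
  shows "mspace (graph_metric H) = pverts H"
  using Metric_space.mspace_metric[OF Metric_space_graph_dist[OF assms]]
  by (simp add: graph_metric_def)

lemma mdist_graph_metric:
  assumes "pair_graph H" "Digraph_Component.connected (with_proj H)"
  shows "mdist (graph_metric H) = graph_dist H"
  using Metric_space.mdist_metric[OF Metric_space_graph_dist[OF assms]]
  by (simp add: graph_metric_def)

lemma connected_K2: "Digraph_Component.connected (with_proj K2)"
proof -
  interpret pair_graph K2 by (rule pair_graph_K2)
  have "u \<rightarrow>\<^sup>*\<^bsub>with_proj K2\<^esub> v" if "u \<in> pverts K2" "v \<in> pverts K2" for u v
  proof (cases "u = v")
    case False
    then have "(u, v) \<in> parcs K2" using that by (auto simp: K2_def)
    then show ?thesis by (auto intro: reachable_adjI)
  qed (use that in auto)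
  then have "u \<rightarrow>\<^sup>*\<^bsub>with_proj (mk_symmetric (with_proj K2))\<^esub> v"
    if "u \<in> pverts K2" "v \<in> pverts K2" for u v
    using that by (intro reachable_mk_symmetricI) auto
  moreover have "pverts (mk_symmetric (with_proj K2)) = pverts K2"
    by (simp add: mk_symmetric_def)
  moreover have "pverts K2 \<noteq> {}"
    by (simp add: K2_def)
  ultimately show ?thesis
    by (simp add: Digraph_Component.connected_def strongly_connected_def)
qed

end

theory Submission
  imports Defs
begin

text \<open>If \<open>h\<close> multiplies all distances by one constant
  \<open>r \<noteq> 0\<close>, then replacing \<open>f\<close> by \<open>h \<circ> f\<close>
  multiplies numerator and denominator of the quotient by the same \<open>r\<^sup>2\<close>
  (\<open>energy_scale\<close>, \<open>dispersion_scale\<close>). So every value attained by maps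
  into the source is attained by maps into the target, and the infimum can only drop
  (\<open>lambda_metric_scale_le\<close>). A space of two points has just one nonzero distance, so
  any injection of the vertices of \<open>K2\<close> into those of \<open>H\<close> is such an
  \<open>h\<close>; one exists because \<open>k > 1\<close>.\<close>

text \<open>
  The Rayleigh quotient is invariant under rescaling the metric, and any two distinct vertices of
  \<open>H\<close> form a rescaled copy of \<open>K2\<close>.
\<close>

lemma on_pair_sq_mdist:
  "on_pair (\<lambda>u v. (mdist X (f u) (f v))\<^sup>2) {u, v} = (mdist X (f u) (f v))\<^sup>2"
  by (rule on_pair_eq) (simp add: mdist_commute[of X "f u"])

lemma on_pair_weighted_sq_mdist:
  "on_pair (\<lambda>u v. (mdist X (f u) (f v))\<^sup>2 * real (degree G u) * real (degree G v)) {u, v}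
    = (mdist X (f u) (f v))\<^sup>2 * real (degree G u) * real (degree G v)"
  by (rule on_pair_eq) (simp add: mdist_commute[of X "f u"])

text \<open>Well-formedness of \<open>G\<close> puts both ends of an edge among the vertices, where
  \<open>f\<close> takes values in \<open>mspace X\<close> and the scaling law of \<open>h\<close>
  applies.\<close>

lemma energy_scale:
  assumes G: "pair_graph G" and f: "f \<in> pverts G \<rightarrow> mspace X"
    and h: "\<And>x y. x \<in> mspace X \<Longrightarrow> y \<in> mspace X \<Longrightarrow> mdist Y (h x) (h y) = r * mdist X x y"
  shows "energy G Y (h \<circ> f) = r\<^sup>2 * energy G X f"
  unfolding energy_def sum_distrib_left
proof (rule sum.cong[OF refl])
  interpret pair_graph G by (rule G)
  fix e assume "e \<in> edges G"
  then obtain u v where e: "e = {u, v}" "(u, v) \<in> parcs G"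
    by (auto simp: edges_def)
  then have "f u \<in> mspace X" "f v \<in> mspace X"
    using f in_arcsD1 in_arcsD2 by blast+
  then show "on_pair (\<lambda>u v. (mdist Y ((h \<circ> f) u) ((h \<circ> f) v))\<^sup>2) e
      = r\<^sup>2 * on_pair (\<lambda>u v. (mdist X (f u) (f v))\<^sup>2) e"
    unfolding e(1) on_pair_sq_mdist
    by (simp add: h power_mult_distrib)
qed

lemma dispersion_scale:
  assumes f: "f \<in> pverts G \<rightarrow> mspace X"
    and h: "\<And>x y. x \<in> mspace X \<Longrightarrow> y \<in> mspace X \<Longrightarrow> mdist Y (h x) (h y) = r * mdist X x y"
  shows "dispersion G Y (h \<circ> f) = r\<^sup>2 * dispersion G X f"
  unfolding dispersion_def sum_distrib_left
proof (rule sum.cong[OF refl])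
  fix e assume "e \<in> vertex_pairs G"
  then obtain u v where e: "e = {u, v}" "u \<in> pverts G" "v \<in> pverts G"
    by (auto simp: vertex_pairs_def)
  then have "f u \<in> mspace X" "f v \<in> mspace X"
    using f by blast+
  then show "on_pair (\<lambda>u v. (mdist Y ((h \<circ> f) u) ((h \<circ> f) v))\<^sup>2
        * real (degree G u) * real (degree G v)) e
      = r\<^sup>2 * on_pair (\<lambda>u v. (mdist X (f u) (f v))\<^sup>2 * real (degree G u) * real (degree G v)) e"
    unfolding e(1) on_pair_weighted_sq_mdist
    by (simp add: h power_mult_distrib)
qed

text \<open>Composition with \<open>h\<close> carries competitors for \<open>X\<close> to
  competitors for \<open>Y\<close> without changing their quotient. Maps into \<open>Y\<close> that
  do not factor through \<open>h\<close> may do better, hence only an inequality.\<close>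

lemma lambda_metric_scale_le:
  assumes G: "pair_graph G" and hX: "h \<in> mspace X \<rightarrow> mspace Y" and r: "r \<noteq> 0"
    and h: "\<And>x y. x \<in> mspace X \<Longrightarrow> y \<in> mspace X \<Longrightarrow> mdist Y (h x) (h y) = r * mdist X x y"
  shows "lambda_metric G Y \<le> lambda_metric G X"
  unfolding lambda_metric_def
proof (rule INF_mono)
  fix f assume "f \<in> {f \<in> pverts G \<rightarrow> mspace X. dispersion G X f \<noteq> 0}"
  then have f: "f \<in> pverts G \<rightarrow> mspace X" and nz: "dispersion G X f \<noteq> 0"
    by auto
  note scale = energy_scale[OF G f h] dispersion_scale[OF f h]
  have "rayleigh G Y (h \<circ> f) = rayleigh G X f"
    using r by (simp add: rayleigh_def scale)
  \<comment> \<open>Since \<open>r \<noteq> 0\<close>, the denominator stays nonzero.\<close>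
  moreover have "h \<circ> f \<in> {g \<in> pverts G \<rightarrow> mspace Y. dispersion G Y g \<noteq> 0}"
    using f hX r nz by (auto simp: scale)
  ultimately show "\<exists>g\<in>{g \<in> pverts G \<rightarrow> mspace Y. dispersion G Y g \<noteq> 0}.
      ereal (rayleigh G Y g) \<le> ereal (rayleigh G X f)"
    by (intro bexI[of _ "h \<circ> f"]) simp_all
qed

theorem theorem1p3:
  fixes G :: "'a pair_pre_digraph" and H :: "'b pair_pre_digraph" and k :: nat
  assumes "pair_graph G"
    and "pair_graph H"
    and "Digraph_Component.connected (with_proj H)"
    and "card (pverts H) = k" and "k > 1"
  shows "lambda_graph G H \<le> lambda_graph G K2"
proof -
  let ?X = "graph_metric K2" and ?Y = "graph_metric H"
  have X: "mspace ?X = {0, 1}"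
    using mspace_graph_metric[OF pair_graph_K2 connected_K2] by (simp add: K2_def)
  have "\<not> card (pverts H) \<le> Suc 0" "finite (pverts H)"
    using assms(4,5) by (auto intro: card_ge_0_finite)
  then obtain a b where ab: "a \<in> mspace ?Y" "b \<in> mspace ?Y" "a \<noteq> b"
    unfolding mspace_graph_metric[OF assms(2,3)] by (auto simp: card_le_Suc0_iff_eq)
  \<comment> \<open>The only possible ratio. The distance in \<open>K2\<close> need not be
    evaluated: it is enough that distinct points have nonzero distance.\<close>
  define r where "r = mdist ?Y a b / mdist ?X 0 1"
  define h :: "nat \<Rightarrow> 'b" where "h n = (if n = 0 then a else b)" for n
  have pos: "mdist ?X 0 1 \<noteq> 0" "mdist ?Y a b \<noteq> 0"
    using ab X by simp_all
  show ?thesis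
    unfolding lambda_graph_def
  proof (rule lambda_metric_scale_le[OF assms(1)])
    show "h \<in> mspace ?X \<rightarrow> mspace ?Y"
      using ab by (auto simp: h_def)
    show "r \<noteq> 0"
      using pos by (simp add: r_def)
    show "mdist ?Y (h x) (h y) = r * mdist ?X x y" if "x \<in> mspace ?X" "y \<in> mspace ?X" for x y
    proof -
      have "(x = 0 \<or> x = 1) \<and> (y = 0 \<or> y = 1)"
        using that X by simp
      \<comment> \<open>Simplification turns the vertex \<open>1\<close> into \<open>Suc 0\<close>,
        so symmetry is instantiated in that form.\<close>
      moreover have "mdist ?Y b a = r * mdist ?X 1 0" "mdist ?Y a b = r * mdist ?X 0 1"
        using pos(1) by (simp_all add: r_def mdist_commute[of _ b] mdist_commute[of _ "Suc 0"])
      moreover have "mdist ?Y a a = 0" "mdist ?Y b b = 0" "mdist ?X 0 0 = 0" "mdist ?X 1 1 = 0"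
        using ab X by simp_all
      ultimately show ?thesis
        by (elim conjE disjE) (simp_all add: h_def)
    qed
  qed
qed

end
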